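(* Let $T$ be a tree of order $n \ge 3$ with maximum degree $\Delta$. Then \[ F_t(T) \le \left( \frac{\Delta}{\Delta + 1} \right) n, \] with equality if and only if $T \cong K_{1,\Delta}$.
   Context: All graphs are finite, simple and undirected. Forcing process: given a graph $G$ and an initial set $S \subseteq V(G)$ of colored vertices (all others non-colored), at each step a colored vertex that has exactly one non-colored neighbor forces (colors) that neighbor. $S$ is a forcing set if iterating this process eventually colors all of $V(G)$. A total forcing set (TF-set) of a graph without isolated vertices is a forcing set $S$ such that the induced subgraph $G[S]$ has no isolated vertex. The total forcing number $F_t(G)$ is the minimum cardinality of a TF-set of $G$. *)

theory Defs
  imports Complex_Main "Graph_Theory.Graph_Theory"
begin

text \<open>
  A finite simple undirected graph is a symmetric digraph, that is, an instance of the locale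
  \<^locale>\<open>graph\<close>: the undirected edge between u and v is the pair of arcs (u,v) and (v,u).
  For such graphs \<^const>\<open>out_degree\<close> is the usual degree.
\<close>

text \<open>
  The library's \<^const>\<open>tree\<close> cannot be used for symmetric digraphs: its notion of cycle admits the
  closed walk u, v, u along the two arcs of a single edge. An undirected cycle has length at
  least 3.
\<close>

definition undirected_cycle :: "('a,'b) pre_digraph \<Rightarrow> 'b awalk \<Rightarrow> bool" where
  "undirected_cycle G p \<longleftrightarrow> pre_digraph.cycle G p \<and> 3 \<le> length p"

definition undirected_tree :: "('a,'b) pre_digraph \<Rightarrow> bool" where
  "undirected_tree G \<longleftrightarrow>
     graph G \<and> Digraph_Component.connected G \<and> \<not> (\<exists>p. undirected_cycle G p)"

definition max_degree :: "('a,'b) pre_digraph \<Rightarrow> nat" where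
  "max_degree G = Max (out_degree G ` verts G)"

definition neighbors :: "('a,'b) pre_digraph \<Rightarrow> 'a \<Rightarrow> 'a set" where
  "neighbors G v = {w. v \<rightarrow>\<^bsub>G\<^esub> w}"

definition isolated :: "('a,'b) pre_digraph \<Rightarrow> 'a \<Rightarrow> bool" where
  "isolated G v \<longleftrightarrow> v \<in> verts G \<and> neighbors G v = {}"

definition force_step :: "('a,'b) pre_digraph \<Rightarrow> 'a set rel" where
  "force_step G = {(C, insert w C) | C v w. v \<in> C \<and> neighbors G v - C = {w}}"

definition forcing_set :: "('a,'b) pre_digraph \<Rightarrow> 'a set \<Rightarrow> bool" where
  "forcing_set G S \<longleftrightarrow> S \<subseteq> verts G \<and> (S, verts G) \<in> (force_step G)\<^sup>*"

definition total_forcing_set :: "('a,'b) pre_digraph \<Rightarrow> 'a set \<Rightarrow> bool" where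
  "total_forcing_set G S \<longleftrightarrow> forcing_set G S \<and> \<not> (\<exists>v. isolated (G \<restriction> S) v)"

text \<open>
  Meaningful only for graphs without isolated vertices, where the minimum is over a nonempty set
  because the whole vertex set is a total forcing set.
\<close>

definition total_forcing_number :: "('a,'b) pre_digraph \<Rightarrow> nat" where
  "total_forcing_number G = Min (card ` {S. total_forcing_set G S})"

lemma total_forcing_set_verts:
  assumes "graph G" and "\<And>v. \<not> isolated G v"
  shows "total_forcing_set G (verts G)"
proof -
  interpret graph G by fact
  have "arcs_ends (G \<restriction> verts G) = arcs_ends G"
    by (auto simp: induce_subgraph_def arcs_ends_conv)
  then have "isolated (G \<restriction> verts G) v \<longleftrightarrow> isolated G v" for v
    by (simp add: isolated_def neighbors_def induce_subgraph_def)
  with assms(2) show ?thesis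
    by (simp add: total_forcing_set_def forcing_set_def)
qed

lemma total_forcing_number_attained:
  assumes "graph G" and "\<And>v. \<not> isolated G v"
  shows "\<exists>S. total_forcing_set G S \<and> card S = total_forcing_number G"
proof -
  interpret graph G by fact
  have "{S. total_forcing_set G S} \<subseteq> Pow (verts G)"
    by (auto simp: total_forcing_set_def forcing_set_def)
  then have "finite {S. total_forcing_set G S}"
    by (rule finite_subset) simp
  moreover have "{S. total_forcing_set G S} \<noteq> {}"
    using total_forcing_set_verts[OF assms] by blast
  ultimately have "total_forcing_number G \<in> card ` {S. total_forcing_set G S}"
    unfolding total_forcing_number_def by (intro Min_in) auto
  then show ?thesis by auto
qed

end

theory Submission
  imports Defs
begin

text \<open>
  Take a dominating set D without leaves in which every d has an external private neighbor p d.
  Then the complement of p ` D is a forcing set, since every d immediately forces p d, and it is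
  total because D contains no leaf. As D dominates, n is at most |D| (\<Delta> + 1), and the bound follows.
  Equality makes the closed neighborhoods of the elements of D a partition of the vertices into
  sets of size \<Delta> + 1. If there are at least two of them, an edge joins a neighbor w of d to a
  neighbor w' of d'; then a further neighbor x of d' can be left uncolored, because w forces w'
  (w and x are not adjacent in a tree) before d' forces x. Totality at d' needs \<Delta> > 2; for
  \<Delta> = 2 any edge is a total forcing set.
\<close>

section \<open>Domination, forcing steps and totality\<close>

definition dominating :: "('a,'b) pre_digraph \<Rightarrow> 'a set \<Rightarrow> bool" where
  "dominating G D \<longleftrightarrow> D \<subseteq> verts G \<and> (\<forall>v\<in>verts G. v \<in> D \<or> neighbors G v \<inter> D \<noteq> {})"

lemma force_step_rtrancl_insert:
  assumes "(S, C) \<in> (force_step G)\<^sup>*" "v \<in> C" "neighbors G v - C = {w}"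
  shows "(S, insert w C) \<in> (force_step G)\<^sup>*"
proof -
  have "(C, insert w C) \<in> force_step G" using assms(2,3) by (auto simp: force_step_def)
  with assms(1) show ?thesis by (rule rtrancl_into_rtrancl)
qed

text \<open>The condition refers only to the initial set \<open>S\<close>: coloring more vertices
  can only shrink the one-element set of uncolored neighbors of \<open>e\<close>. So at the turn of
  \<open>e\<close> the vertex \<open>f e\<close> is either already colored or still forced by
  \<open>e\<close>; \<open>f\<close> may fail to be injective.\<close>

lemma force_step_rtrancl_image:
  assumes "finite F" "\<And>e. e \<in> F \<Longrightarrow> e \<in> S \<and> neighbors G e - S = {f e}"
  shows "(S, S \<union> f ` F) \<in> (force_step G)\<^sup>*"
  using assms
proof (induction F rule: finite_induct)
  case empty
  then show ?case by simp
next
  case (insert e F)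
  then have IH: "(S, S \<union> f ` F) \<in> (force_step G)\<^sup>*" by blast
  have e: "e \<in> S" "neighbors G e - S = {f e}" using insert.prems by blast+
  show ?case
  proof (cases "f e \<in> f ` F")
    case True
    then have "f ` insert e F = f ` F" by blast
    then show ?thesis using IH by metis
  next
    case False
    then have "neighbors G e - (S \<union> f ` F) = {f e}" using e by auto
    moreover have "e \<in> S \<union> f ` F" using e by blast
    ultimately have "(S, insert (f e) (S \<union> f ` F)) \<in> (force_step G)\<^sup>*"
      using force_step_rtrancl_insert[OF IH] by metis
    moreover have "insert (f e) (S \<union> f ` F) = S \<union> f ` insert e F" by blast
    ultimately show ?thesis by metis
  qed
qed

lemma isolated_induce_subgraph_iff:
  "isolated (G \<restriction> S) v \<longleftrightarrow> v \<in> S \<and> neighbors G v \<inter> S = {}"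
proof -
  have "neighbors (G \<restriction> S) v = (if v \<in> S then neighbors G v \<inter> S else {})"
    unfolding neighbors_def arcs_ends_conv induce_subgraph_def by (auto 4 3)
  then show ?thesis by (simp add: isolated_def induce_subgraph_def)
qed

lemma total_forcing_set_iff:
  "total_forcing_set G S \<longleftrightarrow> S \<subseteq> verts G \<and> (S, verts G) \<in> (force_step G)\<^sup>*
    \<and> (\<forall>v\<in>S. neighbors G v \<inter> S \<noteq> {})"
  unfolding total_forcing_set_def forcing_set_def isolated_induce_subgraph_iff by blast

context graph
begin

section \<open>Neighborhoods, degrees and connectedness\<close>

lemma neighbors_subset_verts: "neighbors G v \<subseteq> verts G"
  by (auto simp: neighbors_def adj_in_verts)

lemma finite_neighbors [simp]: "finite (neighbors G v)"
  using neighbors_subset_verts finite_verts by (rule finite_subset)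

lemma neighbors_sym: "w \<in> neighbors G v \<longleftrightarrow> v \<in> neighbors G w"
  unfolding neighbors_def using graph_symmetric by blast

lemma not_in_neighbors_self [simp]: "v \<notin> neighbors G v"
  unfolding neighbors_def using adj_not_same by blast

lemma card_neighbors_le_max_degree:
  assumes "v \<in> verts G"
  shows "card (neighbors G v) \<le> max_degree G"
proof -
  have "neighbors G v = head G ` out_arcs G v"
    by (auto simp: neighbors_def arcs_ends_conv)
  then have "card (neighbors G v) \<le> out_degree G v"
    unfolding out_degree_def by (simp add: card_image_le finite_out_arcs)
  also have "\<dots> \<le> max_degree G"
    unfolding max_degree_def using assms by (intro Max_ge) auto
  finally show ?thesis .
qed

lemma total_forcing_number_le:
  assumes "total_forcing_set G S"
  shows "total_forcing_number G \<le> card S"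
proof -
  have "{S. total_forcing_set G S} \<subseteq> Pow (verts G)"
    by (auto simp: total_forcing_set_iff)
  then have "finite {S. total_forcing_set G S}"
    by (rule finite_subset) simp
  then show ?thesis
    unfolding total_forcing_number_def using assms by (intro Min_le) auto
qed

text \<open>Connectedness is reachability in the symmetric closure, which here has the same
  adjacencies as \<open>G\<close>. A set that no edge leaves is closed under reachability.\<close>

lemma connected_crossing_edge:
  assumes "Digraph_Component.connected G" "C \<subseteq> verts G" "C \<noteq> {}" "C \<noteq> verts G"
  shows "\<exists>v\<in>C. \<exists>w\<in>neighbors G v. w \<notin> C"
proof (rule ccontr)
  assume no: "\<not> ?thesis"
  obtain u z where uz: "u \<in> C" "z \<in> verts G" "z \<notin> C" using assms by blast
  let ?M = "with_proj (mk_symmetric G)"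
  have "u \<rightarrow>\<^sup>*\<^bsub>?M\<^esub> z"
    using assms(1,2) uz unfolding Digraph_Component.connected_def strongly_connected_def
    by (auto simp: mk_symmetric_def)
  then have "(u, z) \<in> (arcs_ends ?M)\<^sup>*" by (rule reachable_rtranclI)
  moreover have "arcs_ends ?M = arcs_ends G"
    using sym_arcs by (auto simp: mk_symmetric_def arcs_ends_conv symmetric_conv)
  ultimately have "(u, z) \<in> (arcs_ends G)\<^sup>*" by simp
  then have "z \<in> C"
    by (induction rule: rtrancl_induct) (use uz no in \<open>auto simp: neighbors_def\<close>)
  with uz show False by simp
qed

section \<open>Dominating sets: counting and private neighbors\<close>

lemma dominating_verts_le:
  assumes "dominating G D"
  shows "card (verts G) \<le> card D * (max_degree G + 1)"
proof -
  have D: "finite D" "D \<subseteq> verts G"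
    using assms finite_subset[OF _ finite_verts] by (auto simp: dominating_def)
  have "verts G \<subseteq> (\<Union>d\<in>D. insert d (neighbors G d))"
    using assms neighbors_sym by (fastforce simp: dominating_def)
  then have "card (verts G) \<le> card (\<Union>d\<in>D. insert d (neighbors G d))"
    using D by (intro card_mono) auto
  also have "\<dots> \<le> (\<Sum>d\<in>D. card (insert d (neighbors G d)))"
    using D by (intro card_UN_le) auto
  also have "\<dots> \<le> card D * (max_degree G + 1)"
    using D card_neighbors_le_max_degree
    by (intro order.trans[OF sum_bounded_above[where K = "max_degree G + 1"]]) (simp_all add: subset_iff)
  finally show ?thesis .
qed

text \<open>The other \<open>card D - 1\<close> closed neighborhoods together cover at most
  \<open>(card D - 1) * (max_degree G + 1)\<close> vertices. Hence the closed neighborhood of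
  \<open>d\<close> must contribute \<open>max_degree G + 1\<close> vertices outside all of them, so
  it has full size and meets none of them.\<close>

lemma dominating_perfect:
  assumes D: "dominating G D" and eq: "card (verts G) = card D * (max_degree G + 1)"
    and d: "d \<in> D"
  shows "card (neighbors G d) = max_degree G"
    and "e \<in> D \<Longrightarrow> e \<noteq> d \<Longrightarrow>
      insert d (neighbors G d) \<inter> insert e (neighbors G e) = {}"
proof -
  let ?N = "\<lambda>d. insert d (neighbors G d)"
  let ?R = "\<Union>e\<in>D - {d}. ?N e"
  have fD: "finite D" "D \<subseteq> verts G"
    using D finite_subset[OF _ finite_verts] by (auto simp: dominating_def)
  have bound: "card (?N e) \<le> max_degree G + 1" if "e \<in> D" for e
    using that fD card_neighbors_le_max_degree by auto
  have "card ?R \<le> (\<Sum>e\<in>D - {d}. card (?N e))"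
    using fD by (intro card_UN_le) auto
  also have "\<dots> \<le> card (D - {d}) * (max_degree G + 1)"
    using bound by (intro order.trans[OF sum_bounded_above[where K = "max_degree G + 1"]]) auto
  finally have R: "card ?R \<le> (card D - 1) * (max_degree G + 1)"
    using d fD by simp
  have "verts G \<subseteq> (?N d - ?R) \<union> ?R"
    using D neighbors_sym by (fastforce simp: dominating_def)
  then have "card (verts G) \<le> card ((?N d - ?R) \<union> ?R)"
    using fD by (intro card_mono) auto
  also have "\<dots> \<le> card (?N d - ?R) + card ?R" by (rule card_Un_le)
  finally have "card D * (max_degree G + 1)
      \<le> card (?N d - ?R) + (card D - 1) * (max_degree G + 1)"
    using R eq by linarith
  moreover have "card D * (max_degree G + 1)
      = (max_degree G + 1) + (card D - 1) * (max_degree G + 1)"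
    using d fD by (metis add.commute card_gt_0_iff empty_iff mult_eq_if not_gr0 not_less0)
  ultimately have ge: "max_degree G + 1 \<le> card (?N d - ?R)" by linarith
  have le: "card (?N d - ?R) \<le> card (?N d)" by (intro card_mono) auto
  with ge bound[OF d] have eqs: "card (?N d) = max_degree G + 1" "card (?N d - ?R) = card (?N d)"
    by linarith+
  show "card (neighbors G d) = max_degree G" using eqs(1) by simp
  have "?N d - ?R = ?N d" using eqs(2) by (intro card_subset_eq) auto
  then show "?N d \<inter> ?N e = {}" if "e \<in> D" "e \<noteq> d" using that by blast
qed

text \<open>
  A variant of a theorem of Bollobas and Cockayne: among the smallest leafless dominating sets
  choose D with the largest number of edges inside D. An element d without external private neighbor
  has no neighbor in D at all, so it can be exchanged for a neighbor w, which gains an edge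
  inside D; w is not a leaf since it has a second neighbor in D.
\<close>

lemma ex_leafless_dominating_private:
  assumes conn: "Digraph_Component.connected G" and n3: "card (verts G) \<ge> 3"
  obtains D p where "dominating G D" "D \<noteq> {}" "\<And>d. d \<in> D \<Longrightarrow> 2 \<le> card (neighbors G d)"
    "\<And>d. d \<in> D \<Longrightarrow> p d \<in> neighbors G d - D \<and> neighbors G (p d) \<inter> D = {d}"
proof -
  let ?P = "\<lambda>D. dominating G D \<and> (\<forall>d\<in>D. 2 \<le> card (neighbors G d))"
  let ?E = "\<lambda>D. {(u, v). u \<in> D \<and> v \<in> D \<and> v \<in> neighbors G u}"
  have ne: "neighbors G v \<noteq> {}" if "v \<in> verts G" for v
  proof -
    have "{v} \<noteq> verts G" using n3 by (auto dest!: arg_cong[where f = card])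
    then show ?thesis using connected_crossing_edge[OF conn, of "{v}"] that by blast
  qed
  \<comment> \<open>Two adjacent vertices of degree at most 1 would make up the whole connected
    graph, which has at least three vertices.\<close>
  have leaf: "2 \<le> card (neighbors G w)"
    if v: "v \<in> verts G" "\<not> 2 \<le> card (neighbors G v)" and w: "w \<in> neighbors G v" for v w
  proof (rule ccontr)
    assume nw: "\<not> 2 \<le> card (neighbors G w)"
    have sub: "{v, w} \<subseteq> verts G" using v w neighbors_subset_verts by auto
    have "{v, w} \<noteq> verts G" using n3 by (auto simp: card_insert_if split: if_splits dest!: arg_cong[where f = card])
    from connected_crossing_edge[OF conn sub _ this] obtain a b where
      ab: "a \<in> {v, w}" "b \<in> neighbors G a" "b \<notin> {v, w}" by blast
    have "card {b, w} \<le> card (neighbors G v)" if "a = v"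
      using that ab w by (intro card_mono) auto
    moreover have "card {b, v} \<le> card (neighbors G w)" if "a = w"
      using that ab w neighbors_sym by (intro card_mono) auto
    ultimately show False using ab v nw by (auto simp: card_insert_if split: if_splits)
  qed
  \<comment> \<open>All non-leaves: this set dominates because the neighbor of a leaf is not a
    leaf.\<close>
  let ?D0 = "{v \<in> verts G. 2 \<le> card (neighbors G v)}"
  have "?P ?D0"
    unfolding dominating_def using ne leaf neighbors_subset_verts by fastforce
  then obtain D1 where D1: "?P D1" "\<And>D. ?P D \<Longrightarrow> card D1 \<le> card D"
    by (metis (no_types, lifting) ex_has_least_nat[of ?P ?D0 card])
  let ?Q = "\<lambda>D. ?P D \<and> card D = card D1"
  have fin: "finite D" if "dominating G D" for D
    using that finite_subset[OF _ finite_verts] by (auto simp: dominating_def)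
  have finE: "finite (?E D)" if "finite D" for D
    using that by (rule_tac finite_subset[of _ "D \<times> D"]) auto
  have Q1: "?Q D1" using D1(1) by blast
  \<comment> \<open>A uniform bound, so that a maximum exists. \<open>?E\<close> consists of ordered
    pairs and counts every edge twice, which does not affect comparisons.\<close>
  have "\<forall>D. ?Q D \<longrightarrow> card (?E D) < Suc (card (verts G \<times> verts G))"
    unfolding less_Suc_eq_le by (intro allI impI card_mono) (auto simp: dominating_def)
  with Q1 have "\<exists>D. ?Q D \<and> (\<forall>D'. ?Q D' \<longrightarrow> card (?E D') \<le> card (?E D))"
    by (rule ex_has_greatest_nat[where P = ?Q and f = "\<lambda>D. card (?E D)"])
  then obtain D where D: "?Q D" "\<And>D'. ?Q D' \<Longrightarrow> card (?E D') \<le> card (?E D)" by blast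
  have fD: "finite D" using D fin by blast
  have DV: "D \<subseteq> verts G" using D by (simp add: dominating_def)
  have "\<exists>w. w \<in> neighbors G d - D \<and> neighbors G w \<inter> D = {d}" if d: "d \<in> D" for d
  proof (rule ccontr)
    assume no: "\<nexists>w. w \<in> neighbors G d - D \<and> neighbors G w \<inter> D = {d}"
    have "\<not> ?P (D - {d})"
      using D1(2)[of "D - {d}"] D(1) d fD by (metis card_Diff1_less not_le)
    then have "\<not> dominating G (D - {d})" using D(1) by blast
    then obtain v where v: "v \<in> verts G" "v \<notin> D - {d}" "neighbors G v \<inter> (D - {d}) = {}"
      using DV by (auto simp: dominating_def)
    \<comment> \<open>A vertex outside \<open>D\<close> whose only neighbor in \<open>D\<close> is
      \<open>d\<close> would be a private neighbor of \<open>d\<close>, so the vertex left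
      undominated is \<open>d\<close> itself.\<close>
    have "v = d"
    proof (rule ccontr)
      assume "v \<noteq> d"
      then have "v \<notin> D" using v by blast
      moreover have "neighbors G v \<inter> D \<noteq> {}" using D(1) v(1) \<open>v \<notin> D\<close> by (auto simp: dominating_def)
      ultimately show False using no v(3) neighbors_sym by blast
    qed
    then have iso: "neighbors G d \<inter> D = {}" using v(3) not_in_neighbors_self[of d] by blast
    obtain w where w: "w \<in> neighbors G d" using ne d DV by blast
    then have wD: "w \<notin> D" using iso by blast
    obtain d' where d': "d' \<in> D" "d' \<in> neighbors G w" "d' \<noteq> d"
      using no w wD d neighbors_sym by blast
    have dw: "d \<in> neighbors G w" using w neighbors_sym by blast
    let ?D' = "insert w (D - {d})"
    have "card {d, d'} \<le> card (neighbors G w)"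
      using d' dw by (intro card_mono) auto
    then have w2: "2 \<le> card (neighbors G w)" using d' by simp
    have "dominating G ?D'"
      unfolding dominating_def
    proof (intro conjI ballI)
      show "?D' \<subseteq> verts G" using DV w neighbors_subset_verts by auto
      fix x assume x: "x \<in> verts G"
      show "x \<in> ?D' \<or> neighbors G x \<inter> ?D' \<noteq> {}"
      proof (cases "x \<in> D")
        case True
        then show ?thesis using w by (cases "x = d") auto
      next
        case False
        then obtain y where y: "y \<in> neighbors G x" "y \<in> D"
          using D(1) x False unfolding dominating_def by blast
        show ?thesis
        \<comment> \<open>A vertex dominated by \<open>d\<close> is not private to \<open>d\<close>,
          so it has a second neighbor in \<open>D\<close>, which survives the exchange.\<close>
        proof (cases "y = d")
          case True
          then have "neighbors G x \<inter> D \<noteq> {d}" "x \<in> neighbors G d"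
            using no False y neighbors_sym by blast+
          then show ?thesis using y True by blast
        next
          case False
          then show ?thesis using y by blast
        qed
      qed
    qed
    moreover have "card ?D' = card D" using card_Suc_Diff1[OF fD d] wD fD by simp
    ultimately have "?Q ?D'" using D(1) w2 by auto
    from D(2)[OF this] have le: "card (?E ?D') \<le> card (?E D)" .
    \<comment> \<open>Removing \<open>d\<close> loses no edge, since \<open>d\<close> has no
      neighbor in \<open>D\<close>; adding \<open>w\<close> gains the edge to
      \<open>d'\<close>.\<close>
    have "?E D \<subseteq> ?E ?D'" using iso neighbors_sym by auto
    moreover have "(w, d') \<in> ?E ?D'" "(w, d') \<notin> ?E D" using d' wD by auto
    ultimately have "?E D \<subset> ?E ?D'" by blast
    then have "card (?E D) < card (?E ?D')"
      using fD by (intro psubset_card_mono finE) auto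
    with le show False by simp
  qed
  then obtain p where p: "\<And>d. d \<in> D \<Longrightarrow> p d \<in> neighbors G d - D \<and> neighbors G (p d) \<inter> D = {d}"
    by metis
  have "verts G \<noteq> {}" using n3 by auto
  then have "D \<noteq> {}" using D(1) by (auto simp: dominating_def)
  with that[of D p] D(1) p show ?thesis by blast
qed

section \<open>Total forcing sets from private neighbors and from a single edge\<close>

text \<open>Privacy makes \<open>p\<close> injective and leaves \<open>p d\<close> as the only
  uncolored neighbor of \<open>d\<close>. For totality, a vertex of \<open>D\<close> has degree at
  least 2 and thus a neighbor besides \<open>p d\<close>, while a vertex outside \<open>D\<close>
  has a neighbor in \<open>D\<close>, which is colored.\<close>

lemma total_forcing_set_private:
  assumes D: "dominating G D" and two: "\<And>d. d \<in> D \<Longrightarrow> 2 \<le> card (neighbors G d)"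
    and p: "\<And>d. d \<in> D \<Longrightarrow> p d \<in> neighbors G d - D \<and> neighbors G (p d) \<inter> D = {d}"
  shows "total_forcing_set G (verts G - p ` D)" "card (verts G - p ` D) = card (verts G) - card D"
proof -
  have DV: "D \<subseteq> verts G" and fD: "finite D"
    using D finite_subset[OF _ finite_verts] by (auto simp: dominating_def)
  have pV: "p ` D \<subseteq> verts G" using p neighbors_subset_verts by blast
  have inj: "inj_on p D" using p by (metis inj_onI singleton_inject)
  show "card (verts G - p ` D) = card (verts G) - card D"
    using pV fD inj by (simp add: card_Diff_subset card_image)
  let ?S = "verts G - p ` D"
  have DS: "D \<subseteq> ?S" using DV p by blast
  have only: "neighbors G d \<inter> p ` D = {p d}" if "d \<in> D" for d
  proof -
    have "e = d" if "e \<in> D" "p e \<in> neighbors G d" for e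
    proof -
      have "d \<in> neighbors G (p e) \<inter> D" using that \<open>d \<in> D\<close> neighbors_sym by blast
      then show ?thesis using p[OF \<open>e \<in> D\<close>] by simp
    qed
    then show ?thesis using that p by auto
  qed
  have force: "d \<in> ?S \<and> neighbors G d - ?S = {p d}" if "d \<in> D" for d
    using that only[OF that] DS neighbors_subset_verts by blast
  have "(?S, ?S \<union> p ` D) \<in> (force_step G)\<^sup>*"
    using force_step_rtrancl_image[OF fD force] by blast
  moreover have "?S \<union> p ` D = verts G" using pV by blast
  moreover have "neighbors G v \<inter> ?S \<noteq> {}" if v: "v \<in> ?S" for v
  proof (cases "v \<in> D")
    case True
    have "\<not> neighbors G v \<subseteq> {p v}"
      using two[OF True] card_mono[of "{p v}" "neighbors G v"] by auto
    then show ?thesis using only[OF True] neighbors_subset_verts[of v] by blast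
  next
    case False
    then have "neighbors G v \<inter> D \<noteq> {}" using v D by (auto simp: dominating_def)
    then show ?thesis using DS by blast
  qed
  ultimately show "total_forcing_set G ?S"
    by (auto simp: total_forcing_set_iff)
qed

text \<open>If every colored vertex has a colored neighbor and degrees are at most 2, a colored
  vertex has at most one uncolored neighbor. So any edge leaving the colored set yields a force, and
  the forced vertex again has a colored neighbor.\<close>

lemma total_forcing_set_edge:
  assumes conn: "Digraph_Component.connected G" and le2: "max_degree G \<le> 2"
    and b: "b \<in> neighbors G a"
  shows "total_forcing_set G {a, b}"
proof -
  have ab: "{a, b} \<subseteq> verts G" using b neighbors_sym neighbors_subset_verts by blast
  \<comment> \<open>The invariant includes totality of the current set; a largest set satisfying it
    must be all of \<open>verts G\<close>.\<close>
  let ?P = "\<lambda>C. ({a, b}, C) \<in> (force_step G)\<^sup>* \<and> C \<subseteq> verts G \<and> {a, b} \<subseteq> C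
    \<and> (\<forall>v\<in>C. neighbors G v \<inter> C \<noteq> {})"
  have P0: "?P {a, b}" using ab b neighbors_sym by auto
  have "\<exists>C. ?P C \<and> (\<forall>C'. ?P C' \<longrightarrow> card C' \<le> card C)"
    using P0 by (rule ex_has_greatest_nat[where P = ?P and b = "Suc (card (verts G))"])
      (simp add: card_mono less_Suc_eq_le)
  then obtain C where C: "?P C" "\<And>C'. ?P C' \<Longrightarrow> card C' \<le> card C" by blast
  have fC: "finite C" using C finite_subset[OF _ finite_verts] by blast
  have "C = verts G"
  proof (rule ccontr)
    assume "C \<noteq> verts G"
    then obtain v w where vw: "v \<in> C" "w \<in> neighbors G v" "w \<notin> C"
      using connected_crossing_edge[OF conn, of C] C(1) by blast
    obtain u where u: "u \<in> neighbors G v" "u \<in> C" using C(1) vw by blast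
    have "neighbors G v = {u, w}"
    proof (rule card_seteq[symmetric])
      have "card (neighbors G v) \<le> 2"
        using card_neighbors_le_max_degree[of v] le2 vw C(1) by force
      then show "card (neighbors G v) \<le> card {u, w}" using u vw by (auto simp: card_insert_if)
    qed (use u vw in auto)
    then have "neighbors G v - C = {w}" using u vw by auto
    then have "({a, b}, insert w C) \<in> (force_step G)\<^sup>*"
      using C(1) vw by (intro force_step_rtrancl_insert) auto
    moreover have "w \<in> verts G" using vw neighbors_subset_verts by blast
    moreover have "v \<in> neighbors G w" using vw neighbors_sym by blast
    ultimately have "?P (insert w C)" using C(1) vw by blast
    from C(2)[OF this] show False using vw fC by simp
  qed
  with C(1) P0 show ?thesis by (auto simp: total_forcing_set_iff)
qed

section \<open>Short cycles and the improvement for two or more closed neighborhoods\<close>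

lemma undirected_tree_no_triangle:
  assumes "undirected_tree G" "b \<in> neighbors G a" "c \<in> neighbors G b"
  shows "a \<notin> neighbors G c"
proof
  assume a: "a \<in> neighbors G c"
  obtain e1 e2 e3 where e: "e1 \<in> arcs G" "tail G e1 = a" "head G e1 = b"
    "e2 \<in> arcs G" "tail G e2 = b" "head G e2 = c" "e3 \<in> arcs G" "tail G e3 = c" "head G e3 = a"
    using assms(2,3) a unfolding neighbors_def arcs_ends_conv by auto
  have "a \<noteq> b" "b \<noteq> c" "c \<noteq> a" using assms(2,3) a by auto
  with e have "cycle [e1, e2, e3]"
    unfolding cycle_def by (intro exI[of _ a]) (auto simp: awalk_simps tail_in_verts[OF e(1), simplified e])
  with assms(1) show False unfolding undirected_tree_def undirected_cycle_def by force
qed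

lemma undirected_tree_no_square:
  assumes "undirected_tree G" "b \<in> neighbors G a" "c \<in> neighbors G b" "d \<in> neighbors G c"
    "a \<noteq> c" "b \<noteq> d"
  shows "a \<notin> neighbors G d"
proof
  assume a: "a \<in> neighbors G d"
  obtain e1 e2 e3 e4 where e: "e1 \<in> arcs G" "tail G e1 = a" "head G e1 = b"
    "e2 \<in> arcs G" "tail G e2 = b" "head G e2 = c" "e3 \<in> arcs G" "tail G e3 = c" "head G e3 = d"
    "e4 \<in> arcs G" "tail G e4 = d" "head G e4 = a"
    using assms(2,3,4) a unfolding neighbors_def arcs_ends_conv by auto
  \<comment> \<open>Adjacent vertices differ; the two diagonals are distinct by assumption, so the
    closed walk repeats no inner vertex.\<close>
  have "a \<noteq> b" "b \<noteq> c" "c \<noteq> d" "d \<noteq> a" using assms(2,3,4) a by auto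
  with e assms(5,6) have "cycle [e1, e2, e3, e4]"
    unfolding cycle_def by (intro exI[of _ a]) (auto simp: awalk_simps tail_in_verts[OF e(1), simplified e])
  with assms(1) show False unfolding undirected_tree_def undirected_cycle_def by force
qed

text \<open>Since the closed neighborhoods are disjoint, every neighbor of \<open>e\<close> outside
  \<open>D\<close> is private to \<open>e\<close>, which leaves \<open>p\<close> free to be chosen.
  The forces come in this order: all of \<open>D\<close> except \<open>d'\<close>, then
  \<open>w\<close> forces \<open>w'\<close>, and finally \<open>d'\<close> forces
  \<open>x\<close>.\<close>

lemma ex_smaller_total_forcing_set:
  assumes tree: "undirected_tree G" and D: "dominating G D"
    and eq: "card (verts G) = card D * (max_degree G + 1)"
    and two: "2 \<le> card D" and deg: "3 \<le> max_degree G"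
  shows "\<exists>S. total_forcing_set G S \<and> card S < card (verts G) - card D"
proof -
  let ?N = "\<lambda>d. insert d (neighbors G d)"
  have DV: "D \<subseteq> verts G" and fD: "finite D"
    using D finite_subset[OF _ finite_verts] by (auto simp: dominating_def)
  note cardN = dominating_perfect(1)[OF D eq]
  note disj = dominating_perfect(2)[OF D eq]
  have uniq: "e = d" if "e \<in> D" "d \<in> D" "x \<in> ?N e" "x \<in> ?N d" for e d x
    using disj[of d e] that by blast
  have conn: "Digraph_Component.connected G" using tree by (simp add: undirected_tree_def)
  obtain d e where de: "d \<in> D" "e \<in> D" "d \<noteq> e"
    using two fD by (metis card_le_Suc0_iff_eq not_less_eq_eq numeral_2_eq_2)
  have "e \<notin> ?N d" using uniq[of d e e] de by blast
  then have "?N d \<noteq> verts G" using de DV by blast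
  then obtain w w' where w: "w \<in> ?N d" and ww': "w' \<in> neighbors G w" and w': "w' \<notin> ?N d"
    using connected_crossing_edge[OF conn, of "?N d"] de DV neighbors_subset_verts by blast
  have wd: "w \<in> neighbors G d" using w w' ww' by blast
  have "w' \<in> verts G" using ww' neighbors_subset_verts by blast
  then obtain d' where d': "d' \<in> D" "w' \<in> ?N d'"
    using D neighbors_sym unfolding dominating_def by blast
  have dd': "d' \<noteq> d" using d' w' by blast
  have "w \<in> neighbors G w'" using ww' neighbors_sym by blast
  then have w'd': "w' \<in> neighbors G d'" using uniq[of d' d w] w d' dd' de by blast
  have "\<not> neighbors G d' \<subseteq> {w'}"
    using cardN[OF d'(1)] deg card_mono[of "{w'}" "neighbors G d'"] by auto
  then obtain x where x: "x \<in> neighbors G d'" "x \<noteq> w'" by blast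
  \<comment> \<open>The vertex \<open>w\<close> has to start colored because it will force
    \<open>w'\<close>, so \<open>p\<close> avoids it. Only at \<open>d'\<close> is the choice
    prescribed.\<close>
  have "\<exists>y. y \<in> neighbors G e \<and> y \<noteq> w \<and> (e = d' \<longrightarrow> y = w')" if e: "e \<in> D" for e
  proof (cases "e = d'")
    case True
    then show ?thesis using w'd' ww' by auto
  next
    case False
    have "\<not> neighbors G e \<subseteq> {w}"
      using cardN[OF e] deg card_mono[of "{w}" "neighbors G e"] by auto
    then show ?thesis using False by blast
  qed
  then obtain p where p: "\<And>e. e \<in> D \<Longrightarrow> p e \<in> neighbors G e \<and> p e \<noteq> w \<and> (e = d' \<longrightarrow> p e = w')"
    by metis
  have pd': "p d' = w'" using p d' by blast
  let ?U = "insert x (p ` D)"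
  let ?S = "verts G - ?U"
  have UV: "?U \<subseteq> verts G" using p x neighbors_subset_verts by blast
  have inj: "inj_on p D" using p uniq by (metis inj_onI insertCI)
  have "x \<notin> p ` D"
  proof
    assume "x \<in> p ` D"
    then obtain e where "e \<in> D" "x = p e" by blast
    then show False using uniq[of e d' x] p[of e] x d' pd' by blast
  qed
  then have cU: "card ?U = card D + 1" using fD inj by (simp add: card_image)
  \<comment> \<open>With truncated subtraction, this is what makes the next inequality
    strict.\<close>
  then have "card D + 1 \<le> card (verts G)" using card_mono[OF finite_verts UV] by simp
  then have card: "card ?S < card (verts G) - card D"
    using UV fD cU by (simp add: card_Diff_subset)
  have UD: "?U \<inter> D = {}"
  proof -
    have "u \<notin> D" if "e \<in> D" "u \<in> neighbors G e" for u e
      using uniq[of e u u] that by auto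
    then show ?thesis using p x d' by blast
  qed
  have DS: "D \<subseteq> ?S" using DV UD by blast
  have only: "neighbors G e \<inter> ?U \<subseteq> {p e} \<union> (if e = d' then {x} else {})" if "e \<in> D" for e
  proof
    fix u assume u: "u \<in> neighbors G e \<inter> ?U"
    show "u \<in> {p e} \<union> (if e = d' then {x} else {})"
    proof (cases "u = x")
      case True
      then show ?thesis using uniq[of e d' x] u x that d' by auto
    next
      case False
      then obtain f where "f \<in> D" "u = p f" using u by blast
      then show ?thesis using uniq[of e f u] p[of f] u that by auto
    qed
  qed
  \<comment> \<open>The vertex \<open>d'\<close> must wait: it has the two uncolored neighbors
    \<open>w'\<close> and \<open>x\<close>.\<close>
  let ?F = "D - {d'}"
  have "e \<in> ?S \<and> neighbors G e - ?S = {p e}" if "e \<in> ?F" for e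
  proof -
    have "neighbors G e - ?S = neighbors G e \<inter> ?U" using neighbors_subset_verts by blast
    also have "\<dots> = {p e}" using only[of e] that p[of e] by auto
    finally show ?thesis using that DS by blast
  qed
  then have "(?S, ?S \<union> p ` ?F) \<in> (force_step G)\<^sup>*"
    using fD by (intro force_step_rtrancl_image) auto
  moreover have "?S \<union> p ` ?F = verts G - {w', x}"
  proof -
    have "p ` ?F = p ` D - {w'}" using inj pd' d' by (auto simp: inj_on_def)
    moreover have "w' \<in> p ` D" using pd' d' by blast
    ultimately show ?thesis using UV \<open>x \<notin> p ` D\<close> by auto
  qed
  ultimately have r1: "(?S, verts G - {w', x}) \<in> (force_step G)\<^sup>*" by simp
  \<comment> \<open>Otherwise \<open>w\<close>, \<open>w'\<close>, \<open>d'\<close>,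
    \<open>x\<close> would form a 4-cycle. Hence \<open>w'\<close> is the only uncolored neighbor of
    \<open>w\<close> at this stage.\<close>
  have "w \<notin> neighbors G x"
  proof (rule undirected_tree_no_square[OF tree ww' _ x(1)])
    show "d' \<in> neighbors G w'" using w'd' neighbors_sym by blast
    show "w \<noteq> d'" using uniq[of d d' w] w d' dd' de by blast
  qed (use x in auto)
  then have "x \<notin> neighbors G w" using neighbors_sym by blast
  then have "neighbors G w - (verts G - {w', x}) = {w'}"
    using ww' neighbors_subset_verts[of w] by blast
  moreover have "w \<in> verts G - {w', x}"
    using wd uniq[of d d' w] x(1) d' dd' de ww' neighbors_subset_verts by auto
  ultimately have "(?S, insert w' (verts G - {w', x})) \<in> (force_step G)\<^sup>*"
    using r1 force_step_rtrancl_insert by metis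
  moreover have "insert w' (verts G - {w', x}) = verts G - {x}" using \<open>w' \<in> verts G\<close> x by blast
  ultimately have r2: "(?S, verts G - {x}) \<in> (force_step G)\<^sup>*" by simp
  have "neighbors G d' - (verts G - {x}) = {x}" "d' \<in> verts G - {x}"
    using x neighbors_subset_verts[of d'] d' DV by auto
  then have "(?S, insert x (verts G - {x})) \<in> (force_step G)\<^sup>*"
    using r2 force_step_rtrancl_insert by metis
  moreover have "insert x (verts G - {x}) = verts G" using UV by blast
  ultimately have r3: "(?S, verts G) \<in> (force_step G)\<^sup>*" by simp
  have "neighbors G v \<inter> ?S \<noteq> {}" if v: "v \<in> ?S" for v
  proof (cases "v \<in> D")
    case True
    \<comment> \<open>At most two neighbors of \<open>v\<close> start uncolored, and its degree is
      at least 3.\<close>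
    have "\<not> neighbors G v \<subseteq> {p v, x}"
      using cardN[OF True] deg card_mono[of "{p v, x}" "neighbors G v"]
      by (auto simp: card_insert_if split: if_splits)
    then obtain u where u: "u \<in> neighbors G v" "u \<noteq> p v" "u \<noteq> x" by blast
    then have "u \<notin> ?U" using only[OF True] by (auto split: if_splits)
    then show ?thesis using u neighbors_subset_verts[of v] by blast
  next
    case False
    then have "neighbors G v \<inter> D \<noteq> {}" using v D by (auto simp: dominating_def)
    then show ?thesis using DS by blast
  qed
  with r3 card show ?thesis by (auto simp: total_forcing_set_iff)
qed

section \<open>Stars\<close>

text \<open>Totality puts the center into the set, since a leaf has no other neighbor. Only the
  center can force leaves, and it is stuck as long as two of them are uncolored, so at most one leaf
  is missing initially.\<close>

lemma star_total_forcing_number_ge: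
  assumes star: "complete_bipartite_digraph 1 m G" and m: "2 \<le> m"
  shows "m \<le> total_forcing_number G" "card (verts G) = m + 1"
proof -
  obtain a V where UV: "verts G = insert a V" "a \<notin> V" "card V = m"
      "arcs_ends G = {a} \<times> V \<union> V \<times> {a}"
    using star unfolding complete_bipartite_digraph_def by (auto simp: card_1_singleton_iff)
  have fV: "finite V" using UV(3) m by (metis card.infinite not_numeral_le_zero)
  show "card (verts G) = m + 1" using UV fV by simp
  have na: "neighbors G a = V" and nV: "\<And>v. v \<in> V \<Longrightarrow> neighbors G v = {a}"
    using UV by (auto simp: neighbors_def)
  have V0: "V \<noteq> {}" using UV(3) m by (metis card.empty not_numeral_le_zero)
  have "\<not> isolated G v" for v
    using na nV V0 UV(1) by (auto simp: isolated_def)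
  then obtain S where S: "total_forcing_set G S" "card S = total_forcing_number G"
    using total_forcing_number_attained[OF graph_axioms] by blast
  have SV: "S \<subseteq> insert a V" and r: "(S, verts G) \<in> (force_step G)\<^sup>*"
    and iso: "\<And>v. v \<in> S \<Longrightarrow> neighbors G v \<inter> S \<noteq> {}"
    using S(1) UV(1) by (auto simp: total_forcing_set_iff)
  have S0: "S \<noteq> {}"
  proof
    assume "S = {}"
    with r UV(1) show False
      by (auto simp: force_step_def elim: converse_rtranclE)
  qed
  have aS: "a \<in> S"
  proof (rule ccontr)
    assume "a \<notin> S"
    then obtain s where "s \<in> S" "s \<in> V" using S0 SV by blast
    then show False using iso[of s] nV[of s] \<open>a \<notin> S\<close> by simp
  qed
  have "x = y" if xy: "x \<in> V - S" "y \<in> V - S" for x y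
  proof (rule ccontr)
    assume neq: "x \<noteq> y"
    \<comment> \<open>Neither of two initially uncolored leaves is ever forced: the forcing vertex
      would be the center, which still has both as uncolored neighbors.\<close>
    have "C \<inter> {x, y} = {}" if "(S, C) \<in> (force_step G)\<^sup>*" for C
      using that
    proof (induction rule: rtrancl_induct)
      case base
      then show ?case using xy by blast
    next
      case (step C C')
      then obtain v w where vw: "C' = insert w C" "v \<in> C" "neighbors G v - C = {w}"
        by (auto simp: force_step_def)
      have "v = a" if "w \<in> V"
        using that vw neighbors_sym nV by blast
      then have "{x, y} \<subseteq> {w}" if "w \<in> {x, y}" using that vw(3) na step.IH xy by blast
      then show ?case using vw(1) neq step.IH by blast
    qed
    from this[OF r] UV(1) xy show False by blast
  qed
  then have "card (V - S) \<le> Suc 0" using fV by (subst card_le_Suc0_iff_eq) auto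
  moreover have "V - S = verts G - S" using UV(1) aS by auto
  moreover have "card (verts G - S) = card (verts G) - card S"
    using SV UV(1) fV finite_subset by (intro card_Diff_subset) auto
  ultimately show "m \<le> total_forcing_number G"
    using \<open>card (verts G) = m + 1\<close> S(2) by simp
qed

end

section \<open>The bound and its equality case\<close>

theorem theorem2:
  fixes T :: "('a, 'b) pre_digraph" and n \<Delta> :: nat
  assumes "undirected_tree T"
    and "card (verts T) = n" and "n \<ge> 3"
    and "max_degree T = \<Delta>"
  shows "real (total_forcing_number T) \<le> (real \<Delta> / (real \<Delta> + 1)) * real n \<and>
    (real (total_forcing_number T) = (real \<Delta> / (real \<Delta> + 1)) * real n
      \<longleftrightarrow> complete_bipartite_digraph 1 \<Delta> T)"
proof -
  interpret graph T using assms(1) by (simp add: undirected_tree_def)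
  have conn: "Digraph_Component.connected T" using assms(1) by (simp add: undirected_tree_def)
  let ?F = "total_forcing_number T"
  obtain D p where D: "dominating T D" "D \<noteq> {}" and two: "\<And>d. d \<in> D \<Longrightarrow> 2 \<le> card (neighbors T d)"
    and p: "\<And>d. d \<in> D \<Longrightarrow> p d \<in> neighbors T d - D \<and> neighbors T (p d) \<inter> D = {d}"
    using ex_leafless_dominating_private[OF conn] assms(2,3) by metis
  have DV: "D \<subseteq> verts T" and fD: "finite D"
    using D finite_subset[OF _ finite_verts] by (auto simp: dominating_def)
  define k where "k = card D"
  have k1: "1 \<le> k" using D fD by (simp add: k_def Suc_le_eq card_gt_0_iff)
  have kn: "k \<le> n" using DV assms(2) card_mono[OF finite_verts] by (auto simp: k_def)
  have d2: "2 \<le> \<Delta>"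
    using D(2) two DV card_neighbors_le_max_degree assms(4) order_trans by blast
  have Fle: "?F \<le> n - k"
    using total_forcing_set_private[OF D(1) two p] total_forcing_number_le assms(2)
    by (metis k_def)
  have nle: "n \<le> k * (\<Delta> + 1)"
    using dominating_verts_le[OF D(1)] assms(2,4) by (simp add: k_def)
  \<comment> \<open>Expanding gives n * \<Delta> + (n - k * (\<Delta> + 1)), where the bracket is at
    most 0 by domination.\<close>
  have "?F * (\<Delta> + 1) \<le> (n - k) * (\<Delta> + 1)" using Fle by (rule mult_le_mono1)
  also have "\<dots> = n * (\<Delta> + 1) - k * (\<Delta> + 1)" by (rule diff_mult_distrib)
  finally have main: "?F * (\<Delta> + 1) \<le> n * \<Delta>" using nle by simp
  have toNat: "real ?F = (real \<Delta> / (real \<Delta> + 1)) * real n \<longleftrightarrow> ?F * (\<Delta> + 1) = n * \<Delta>"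
    by (simp add: field_simps flip: of_nat_mult of_nat_add of_nat_Suc)
  have "complete_bipartite_digraph 1 \<Delta> T" if eqF: "?F * (\<Delta> + 1) = n * \<Delta>"
  proof -
    have "n * \<Delta> \<le> n * (\<Delta> + 1) - k * (\<Delta> + 1)"
      using \<open>?F * (\<Delta> + 1) \<le> (n - k) * (\<Delta> + 1)\<close> eqF by (metis diff_mult_distrib)
    \<comment> \<open>This rules out truncation in the preceding difference, which then yields k *
      (\<Delta> + 1) \<le> n, the reverse of \<open>nle\<close>.\<close>
    moreover have "k * (\<Delta> + 1) \<le> n * (\<Delta> + 1)" using kn by (rule mult_le_mono1)
    ultimately have n: "n = k * (\<Delta> + 1)" using nle by (simp add: algebra_simps)
    have "?F * (\<Delta> + 1) = (k * \<Delta>) * (\<Delta> + 1)" using eqF n by (simp add: mult_ac)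
    then have F: "?F = k * \<Delta>" by (metis Suc_eq_plus1 mult_cancel2 nat.simps(3))
    have eq: "card (verts T) = card D * (max_degree T + 1)"
      using n assms(2,4) by (simp add: k_def)
    have "\<not> 2 \<le> k"
    proof
      assume k2: "2 \<le> k"
      have "\<exists>S. total_forcing_set T S \<and> card S < n - k"
      \<comment> \<open>For \<Delta> = 2 an edge suffices: n = 3 * k gives n - k = 2 * k, at least
        4. Otherwise \<Delta> is at least 3.\<close>
      proof (cases "\<Delta> = 2")
        case True
        obtain d where "d \<in> D" using D by blast
        then have "p d \<in> neighbors T d" using p by blast
        from total_forcing_set_edge[OF conn _ this] have "total_forcing_set T {d, p d}"
          using True assms(4) by simp
        moreover have "card {d, p d} < n - k"
          using True n k2 by (auto simp: card_insert_if)
        ultimately show ?thesis by blast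
      next
        case False
        then show ?thesis
          using ex_smaller_total_forcing_set[OF assms(1) D(1) eq] k2 d2 assms(2,4)
          by (simp add: k_def)
      qed
      then have "?F < n - k" using total_forcing_number_le by (meson le_less_trans)
      then show False using F n by simp
    qed
    \<comment> \<open>A single vertex \<open>d\<close> dominates the tree, and its neighbors are
      pairwise nonadjacent because there are no triangles: a star.\<close>
    then have "card D = 1" using k1 by (simp add: k_def)
    then obtain d where d: "D = {d}" by (auto simp: card_1_singleton_iff)
    have V: "verts T = {d} \<union> neighbors T d"
      using D(1) d neighbors_sym neighbors_subset_verts unfolding dominating_def by blast
    have card: "card (neighbors T d) = \<Delta>"
      using dominating_perfect(1)[OF D(1) eq] d assms(4) by simp
    have no: "v \<notin> neighbors T u" if "u \<in> neighbors T d" "v \<in> neighbors T d" for u v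
      using undirected_tree_no_triangle[OF assms(1) that(1)] that(2) neighbors_sym by blast
    have "arcs_ends T = {d} \<times> neighbors T d \<union> neighbors T d \<times> {d}"
    proof (intro set_eqI iffI; clarify)
      fix u v assume uv: "u \<rightarrow>\<^bsub>T\<^esub> v" "\<not> (u \<in> neighbors T d \<and> v \<in> {d})"
      then have "v \<in> neighbors T u" "u \<in> verts T" "v \<in> verts T"
        by (auto simp: neighbors_def adj_in_verts)
      show "u \<in> {d} \<and> v \<in> neighbors T d"
      proof (cases "u = d")
        case True
        then show ?thesis using \<open>v \<in> neighbors T u\<close> by simp
      next
        case False
        then have "u \<in> neighbors T d" using \<open>u \<in> verts T\<close> V by simp
        then have "v \<in> neighbors T d" using uv(2) \<open>v \<in> verts T\<close> V by simp
        then show ?thesis using no[OF \<open>u \<in> neighbors T d\<close>] \<open>v \<in> neighbors T u\<close> by simp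
      qed
    next
      fix u v assume "(u, v) \<in> {d} \<times> neighbors T d \<union> neighbors T d \<times> {d}"
      then show "u \<rightarrow>\<^bsub>T\<^esub> v" using graph_symmetric by (auto simp: neighbors_def)
    qed
    then show ?thesis
      unfolding complete_bipartite_digraph_def
      using V card graph_axioms by (intro conjI exI[of _ "{d}"] exI[of _ "neighbors T d"]) auto
  qed
  moreover have "?F * (\<Delta> + 1) = n * \<Delta>" if star: "complete_bipartite_digraph 1 \<Delta> T"
  proof -
    have "\<Delta> \<le> ?F" "n = \<Delta> + 1"
      using star_total_forcing_number_ge[OF star d2] assms(2) by auto
    \<comment> \<open>For the star the lower bound \<Delta> on \<open>?F\<close> meets the upper
      bound \<open>main\<close>.\<close>
    then have "n * \<Delta> \<le> ?F * (\<Delta> + 1)" by (metis mult.commute mult_le_mono1)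
    with main show ?thesis by simp
  qed
  moreover have "real ?F \<le> (real \<Delta> / (real \<Delta> + 1)) * real n"
  proof -
    have "real (?F * (\<Delta> + 1)) \<le> real (n * \<Delta>)" using main of_nat_le_iff by blast
    then show ?thesis by (simp add: field_simps)
  qed
  ultimately show ?thesis using toNat by blast
qed

end
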